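(* Let $k$ be a positive integer. If $G$ is a connected $(P_k,E)$-free graph, then \[ c(G) \leq \Big\lceil \frac{k-1}{2}\Big\rceil+3. \]
   Context: The graph $E$ is obtained from the claw $K_{1,3}$ by subdividing two of its edges once: it has vertices $c,a,b_1,b_2,d_1,d_2$ and edges $ca, cb_1, b_1b_2, cd_1, d_1d_2$. $P_k$ is the path on $k$ vertices. A graph is $(H_1,H_2)$-free if it has no induced subgraph isomorphic to $H_1$ or $H_2$. Cops and Robbers is played on a connected graph: first the cops are placed on vertices, then the robber chooses a vertex; players alternate turns (cops first), each cop/robber moving to an adjacent vertex or staying put; the cops win if a cop eventually moves onto the robber's vertex. The cop number $c(G)$ is the least number of cops guaranteeing a cop win. *)

theory Defs
  imports Complex_Main "Graph_Theory.Graph_Theory"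
begin

text \<open>
  Finite simple undirected graphs are the symmetric, loop-free, finite digraphs of the locale
  \<^locale>\<open>pair_graph\<close>: an edge \<open>uv\<close> is the pair of arcs \<open>(u, v)\<close>, \<open>(v, u)\<close>.
\<close>

definition path_graph :: "nat \<Rightarrow> nat pair_pre_digraph" where
  "path_graph k =
     \<lparr> pverts = {..<k}, parcs = {(i, j). i < k \<and> j < k \<and> (j = Suc i \<or> i = Suc j)} \<rparr>"

datatype E_vertex = E_c | E_a | E_b1 | E_b2 | E_d1 | E_d2

definition E_graph :: "E_vertex pair_pre_digraph" where
  "E_graph =
     (let edges = {(E_c, E_a), (E_c, E_b1), (E_b1, E_b2), (E_c, E_d1), (E_d1, E_d2)}
      in \<lparr> pverts = {E_c, E_a, E_b1, E_b2, E_d1, E_d2}, parcs = edges \<union> edges\<inverse> \<rparr>)"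

definition induced_free :: "'a pair_pre_digraph \<Rightarrow> 'h pair_pre_digraph \<Rightarrow> bool" where
  "induced_free G H \<longleftrightarrow>
     \<not> (\<exists>K. induced_subgraph K (with_proj G) \<and> digraph_iso (with_proj H) K)"

text \<open>The trajectory of one player: in each step it moves along an edge or stays put.\<close>

definition legal_moves :: "'a pair_pre_digraph \<Rightarrow> (nat \<Rightarrow> 'a) \<Rightarrow> bool" where
  "legal_moves G w \<longleftrightarrow>
     w 0 \<in> pverts G \<and> (\<forall>t. w (Suc t) = w t \<or> (w t, w (Suc t)) \<in> parcs G)"

text \<open>
  A strategy \<open>\<sigma>\<close> for \<open>m\<close> cops maps the list of robber positions seen so far to the positions
  \<open>\<sigma> h i\<close> of the cops \<open>i < m\<close>. In particular \<open>\<sigma> []\<close> is the initial placement, chosen before the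
  robber appears, and the cops' turn number \<open>t + 1\<close> may depend on the robber positions
  \<open>r 0, \<dots>, r t\<close>. As \<open>\<sigma>\<close> is deterministic, the earlier cop positions are recoverable from this
  history.
\<close>

definition cop_trajectory :: "('a list \<Rightarrow> nat \<Rightarrow> 'a) \<Rightarrow> (nat \<Rightarrow> 'a) \<Rightarrow> nat \<Rightarrow> nat \<Rightarrow> 'a" where
  "cop_trajectory \<sigma> r i t = \<sigma> (map r [0..<t]) i"

text \<open>
  The robber is at \<open>r t\<close> during the cops' turn number \<open>t + 1\<close>, so capture means that after this
  turn some cop is at \<open>r t\<close>. A robber who enters an occupied vertex is caught by a cop staying put
  there. Plays are continued beyond the capture, which has no influence on the outcome.
\<close>

definition winning_strategy ::
    "'a pair_pre_digraph \<Rightarrow> nat \<Rightarrow> ('a list \<Rightarrow> nat \<Rightarrow> 'a) \<Rightarrow> bool" where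
  "winning_strategy G m \<sigma> \<longleftrightarrow>
     (\<forall>r. legal_moves G r \<longrightarrow>
        (\<forall>i<m. legal_moves G (cop_trajectory \<sigma> r i)) \<and>
        (\<exists>t. \<exists>i<m. cop_trajectory \<sigma> r i (Suc t) = r t))"

definition cops_win :: "'a pair_pre_digraph \<Rightarrow> nat \<Rightarrow> bool" where
  "cops_win G m \<longleftrightarrow> (\<exists>\<sigma>. winning_strategy G m \<sigma>)"

definition cop_number :: "'a pair_pre_digraph \<Rightarrow> nat" where
  "cop_number G = (LEAST m. cops_win G m)"

lemma pair_graph_path_graph: "pair_graph (path_graph k)"
  by unfold_locales
     (auto simp: path_graph_def symmetric_def sym_def
           intro: finite_subset[of _ "{..<k} \<times> {..<k}"])

lemma pair_graph_E_graph: "pair_graph E_graph"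
  by unfold_locales (auto simp: E_graph_def symmetric_def sym_def)

text \<open>The minimum defining the cop number is over a nonempty set.\<close>

lemma cops_win_card:
  assumes "pair_graph G"
  shows "cops_win G (card (pverts G))"
proof -
  have "finite (pverts G)"
    using assms by (simp add: pair_graph_def pair_digraph_def pair_fin_digraph.pair_finite_verts)
  then obtain f where f: "bij_betw f {0..<card (pverts G)} (pverts G)"
    using ex_bij_betw_nat_finite by blast
  have "winning_strategy G (card (pverts G)) (\<lambda>_. f)"
    unfolding winning_strategy_def cop_trajectory_def
  proof (intro allI impI conjI)
    fix i assume "i < card (pverts G)"
    then show "legal_moves G (\<lambda>t. f i)"
      using f by (auto simp: legal_moves_def bij_betw_def)
  next
    fix r assume "legal_moves G r"
    then have "r 0 \<in> f ` {0..<card (pverts G)}"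
      using f by (simp add: legal_moves_def bij_betw_def)
    then show "\<exists>t. \<exists>i<card (pverts G). f i = r t"
      by (metis atLeastLessThan_iff imageE)
  qed
  then show ?thesis
    unfolding cops_win_def by blast
qed

lemma cops_win_cop_number: "pair_graph G \<Longrightarrow> cops_win G (cop_number G)"
  unfolding cop_number_def by (rule LeastI[of "cops_win G"]) (rule cops_win_card)

end

theory Submission
  imports Defs
begin

text \<open>
  Gyarfas' path argument. Let \<open>v\<^sub>0 \<dots> v\<^sub>p\<close> be an induced path and let the robber live in a connected
  territory \<open>R\<close> that avoids the closed neighbourhood of \<open>v\<^sub>0, \<dots>, v\<^bsub>p-1\<^esub>\<close>, can be left only into
  it, and meets the closed neighbourhood of \<open>v\<^sub>p\<close>. Consider an exit \<open>w\<close>, adjacent to \<open>r \<in> R\<close>, and its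
  last neighbour \<open>v\<^sub>j\<close> with \<open>j < p\<close>. If \<open>0 < j < p - 2\<close>, then \<open>w\<close> is also adjacent to \<open>v\<^bsub>j-1\<^esub>\<close>, since
  otherwise \<open>v\<^sub>j\<close> would be the centre of an induced \<open>E\<close> with legs \<open>v\<^bsub>j-1\<^esub>\<close>, \<open>w r\<close> and
  \<open>v\<^bsub>j+1\<^esub> v\<^bsub>j+2\<^esub>\<close>. So cops on the vertices of even index and on the last two vertices of
  \<open>v\<^sub>0 \<dots> v\<^bsub>p-1\<^esub>\<close> confine the robber to \<open>R\<close> while a spare cop walks to \<open>v\<^sub>p\<close>. The robber is then left
  with a component of \<open>R\<close> minus the closed neighbourhood of \<open>v\<^sub>p\<close>, and the path can be prolonged by a
  vertex of \<open>R\<close> next to this component. As there is no induced \<open>P\<^sub>k\<close>, this must stop.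
\<close>

section \<open>Induced subgraphs as embeddings\<close>

definition induced_embedding :: "'a pair_pre_digraph \<Rightarrow> 'h pair_pre_digraph \<Rightarrow> ('h \<Rightarrow> 'a) \<Rightarrow> bool" where
  "induced_embedding G H f \<longleftrightarrow>
     inj_on f (pverts H) \<and> f ` pverts H \<subseteq> pverts G \<and>
     (\<forall>x \<in> pverts H. \<forall>y \<in> pverts H. (f x, f y) \<in> parcs G \<longleftrightarrow> (x, y) \<in> parcs H)"

text \<open>The subgraph induced on the image of \<open>f\<close> is the image of \<open>H\<close>
  under the isomorphism acting by \<open>f\<close> on vertices and componentwise on arcs. So a
  forbidden graph can be exhibited by naming its vertices.\<close>

lemma induced_embedding_not_induced_free:
  assumes G: "pair_graph G" and H: "pair_graph H" and f: "induced_embedding G H f"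
  shows "\<not> induced_free G H"
proof -
  interpret G: pair_graph G by fact
  interpret H: pair_graph H by fact
  define K where "K = with_proj G \<restriction> (f ` pverts H)"
  define h where "h = \<lparr>iso_verts = f, iso_arcs = map_prod f f, iso_head = snd, iso_tail = fst\<rparr>"
  have inj: "inj_on f (pverts H)" and sub: "f ` pverts H \<subseteq> pverts G"
    and arcs: "\<And>x y. x \<in> pverts H \<Longrightarrow> y \<in> pverts H \<Longrightarrow> (f x, f y) \<in> parcs G \<longleftrightarrow> (x, y) \<in> parcs H"
    using f by (auto simp: induced_embedding_def)
  have "induced_subgraph K (with_proj G)"
    unfolding K_def by (rule G.induced_induce) (use sub in simp)
  moreover have "inj_on (map_prod f f) (parcs H)"
    by (rule inj_on_subset[OF map_prod_inj_on[OF inj inj]]) (auto dest: H.in_arcsD1 H.in_arcsD2)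
  then have "pre_digraph.digraph_isomorphism (with_proj H) h"
    using inj H.wf_digraph_axioms by (auto simp: pre_digraph.digraph_isomorphism_def h_def)
  moreover have "{e \<in> parcs G. fst e \<in> f ` pverts H \<and> snd e \<in> f ` pverts H} = map_prod f f ` parcs H"
  proof (intro subset_antisym subsetI)
    fix e assume "e \<in> {e \<in> parcs G. fst e \<in> f ` pverts H \<and> snd e \<in> f ` pverts H}"
    then obtain x y where "e = (f x, f y)" "x \<in> pverts H" "y \<in> pverts H" "e \<in> parcs G"
      by (cases e) auto
    then show "e \<in> map_prod f f ` parcs H"
      using arcs by (auto intro!: image_eqI[where x = "(x, y)"])
  next
    fix e assume "e \<in> map_prod f f ` parcs H"
    then obtain x y where "e = (f x, f y)" "(x, y) \<in> parcs H"
      by auto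
    then show "e \<in> {e \<in> parcs G. fst e \<in> f ` pverts H \<and> snd e \<in> f ` pverts H}"
      using arcs H.in_arcsD1 H.in_arcsD2 by auto
  qed
  then have "K = app_iso h (with_proj H)"
    by (simp add: K_def h_def app_iso_def induce_subgraph_def)
  ultimately show ?thesis
    unfolding induced_free_def digraph_iso_def by blast
qed

section \<open>Lost positions\<close>

text \<open>The cops, standing at \<open>c 0, \<dots>, c (m - 1)\<close>, are to move and the robber is at \<open>r\<close>.\<close>

inductive robber_lost :: "'a pair_pre_digraph \<Rightarrow> nat \<Rightarrow> (nat \<Rightarrow> 'a) \<Rightarrow> 'a \<Rightarrow> bool"
  for G :: "'a pair_pre_digraph" and m :: nat where
  capture: "\<lbrakk>\<And>i. i < m \<Longrightarrow> (c i, c' i) \<in> (parcs G)\<^sup>=; i < m; c' i = r\<rbrakk> \<Longrightarrow> robber_lost G m c r"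
| pursue: "\<lbrakk>\<And>i. i < m \<Longrightarrow> (c i, c' i) \<in> (parcs G)\<^sup>=; \<And>r'. (r, r') \<in> (parcs G)\<^sup>= \<Longrightarrow> robber_lost G m c' r'\<rbrakk>
    \<Longrightarrow> robber_lost G m c r"

definition winning_from ::
    "'a pair_pre_digraph \<Rightarrow> nat \<Rightarrow> (nat \<Rightarrow> 'a) \<Rightarrow> 'a \<Rightarrow> ('a list \<Rightarrow> nat \<Rightarrow> 'a) \<Rightarrow> bool" where
  "winning_from G m c r \<sigma> \<longleftrightarrow> \<sigma> [] = c \<and>
     (\<forall>w. legal_moves G w \<longrightarrow> w 0 = r \<longrightarrow>
        (\<forall>i<m. legal_moves G (cop_trajectory \<sigma> w i)) \<and>
        (\<exists>t. \<exists>i<m. cop_trajectory \<sigma> w i (Suc t) = w t))"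

lemma robber_lost_capture:
  assumes "i < m" and "(c i, r) \<in> (parcs G)\<^sup>="
  shows "robber_lost G m c r"
  by (rule capture[where c' = "c(i := r)" and i = i]) (use assms in auto)

lemma cop_trajectory_Suc:
  "cop_trajectory \<sigma> w i (Suc t) = cop_trajectory (\<lambda>h. \<sigma> (w 0 # h)) (w \<circ> Suc) i t"
proof -
  have "map w [0..<Suc t] = w 0 # map (w \<circ> Suc) [0..<t]"
    by (simp add: upt_conv_Cons map_Suc_upt[symmetric] del: upt_Suc)
  then show ?thesis
    by (simp only: cop_trajectory_def)
qed

lemma legal_moves_Suc:
  assumes "pair_graph G" and "legal_moves G w"
  shows "legal_moves G (w \<circ> Suc)"
proof -
  interpret pair_graph G by fact
  show ?thesis
    using assms(2) in_arcsD2 unfolding legal_moves_def comp_apply by metis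
qed

text \<open>Induction along \<open>robber_lost\<close> turns an analysis of positions into a
  strategy on histories: the strategies for the possible replies of the robber are glued
  together.\<close>

lemma robber_lost_winning_from:
  assumes G: "pair_graph G" and "robber_lost G m c r" and "c ` {..<m} \<subseteq> pverts G"
  shows "\<exists>\<sigma>. winning_from G m c r \<sigma>"
  using assms(2,3)
proof induction
  case (capture c c' i r)
  define \<sigma> where "\<sigma> h = (if h = [] then c else c')" for h :: "'a list"
  have "cop_trajectory \<sigma> w j t = (if t = 0 then c j else c' j)" for w j t
    by (simp add: cop_trajectory_def \<sigma>_def)
  then have "legal_moves G (cop_trajectory \<sigma> w j)" if "j < m" for w j
    using capture.hyps(1)[OF that] capture.prems that by (auto simp: legal_moves_def)
  moreover have "cop_trajectory \<sigma> w i (Suc 0) = r" for w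
    using capture.hyps(3) by (simp add: cop_trajectory_def \<sigma>_def)
  ultimately have "winning_from G m c r \<sigma>"
    using capture.hyps(2) unfolding winning_from_def by (metis \<sigma>_def)
  then show ?case by blast
next
  case (pursue c c' r)
  interpret pair_graph G by fact
  have "c' ` {..<m} \<subseteq> pverts G"
  proof clarify
    fix i assume i: "i < m"
    then show "c' i \<in> pverts G"
      using pursue.hyps(1)[OF i] pursue.prems by (auto dest: in_arcsD2)
  qed
  then obtain \<tau> where \<tau>: "\<And>r'. (r, r') \<in> (parcs G)\<^sup>= \<Longrightarrow> winning_from G m c' r' (\<tau> r')"
    using pursue.IH by metis
  \<comment> \<open>On a one-entry history the reply is still unknown; \<open>c'\<close> is the
    placement shared by all \<open>\<tau> r'\<close>. Afterwards the second entry is the reply and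
    selects a strategy, which sees the history without its first entry.\<close>
  define \<sigma> where "\<sigma> h = (if h = [] then c else if tl h = [] then c' else \<tau> (hd (tl h)) (tl h))" for h
  have "(\<forall>i<m. legal_moves G (cop_trajectory \<sigma> w i)) \<and>
      (\<exists>t. \<exists>i<m. cop_trajectory \<sigma> w i (Suc t) = w t)"
    if w: "legal_moves G w" "w 0 = r" for w
  proof -
    have "(r, w 1) \<in> (parcs G)\<^sup>="
      using w(1)[unfolded legal_moves_def, THEN conjunct2, THEN spec, of 0] w(2) by auto
    note win = \<tau>[OF this]
    have shift: "cop_trajectory \<sigma> w i (Suc t) = cop_trajectory (\<tau> (w 1)) (w \<circ> Suc) i t" for i t
    proof (cases t)
      case 0
      then show ?thesis
        using win by (simp add: cop_trajectory_def \<sigma>_def winning_from_def)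
    next
      case (Suc s)
      then show ?thesis
        unfolding cop_trajectory_Suc
        by (simp add: cop_trajectory_def \<sigma>_def hd_map del: upt_Suc)
    qed
    have start: "cop_trajectory \<sigma> w i 0 = c i" "cop_trajectory \<sigma> w i (Suc 0) = c' i" for i
      by (simp_all add: cop_trajectory_def \<sigma>_def)
    have win': "(\<forall>i<m. legal_moves G (cop_trajectory (\<tau> (w 1)) (w \<circ> Suc) i)) \<and>
        (\<exists>t. \<exists>i<m. cop_trajectory (\<tau> (w 1)) (w \<circ> Suc) i (Suc t) = (w \<circ> Suc) t)"
      using win legal_moves_Suc[OF G w(1)] unfolding winning_from_def by (metis One_nat_def comp_apply)
    have "legal_moves G (cop_trajectory \<sigma> w i)" if i: "i < m" for i
      unfolding legal_moves_def
    proof (intro conjI allI)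
      show "cop_trajectory \<sigma> w i 0 \<in> pverts G"
        using pursue.prems i by (auto simp: start)
    next
      fix t
      show "cop_trajectory \<sigma> w i (Suc t) = cop_trajectory \<sigma> w i t \<or>
          (cop_trajectory \<sigma> w i t, cop_trajectory \<sigma> w i (Suc t)) \<in> parcs G"
      proof (cases t)
        case 0
        then show ?thesis
          using pursue.hyps(1)[OF i] by (auto simp: start)
      next
        case (Suc s)
        then show ?thesis
          using win' i by (simp add: shift legal_moves_def)
      qed
    qed
    moreover have "\<exists>t. \<exists>i<m. cop_trajectory \<sigma> w i (Suc t) = w t"
      using win' by (metis shift comp_apply)
    ultimately show ?thesis by blast
  qed
  then have "winning_from G m c r \<sigma>"
    by (simp add: winning_from_def \<sigma>_def)
  then show ?case by blast
qed

text \<open>The strategies for the various \<open>r\<close> share the placement \<open>c\<close>, so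
  the choice among them can wait until the robber has appeared.\<close>

lemma robber_lost_cops_win:
  assumes G: "pair_graph G" and c: "c ` {..<m} \<subseteq> pverts G"
    and lost: "\<And>r. r \<in> pverts G \<Longrightarrow> robber_lost G m c r"
  shows "cops_win G m"
proof -
  obtain \<tau> where \<tau>: "\<And>r. r \<in> pverts G \<Longrightarrow> winning_from G m c r (\<tau> r)"
    using robber_lost_winning_from[OF G lost c] by metis
  define \<sigma> where "\<sigma> h = (if h = [] then c else \<tau> (hd h) h)" for h
  have "cop_trajectory \<sigma> w = cop_trajectory (\<tau> (w 0)) w" if "w 0 \<in> pverts G" for w
  proof (intro ext)
    fix i t
    show "cop_trajectory \<sigma> w i t = cop_trajectory (\<tau> (w 0)) w i t"
      using \<tau>[OF that] by (cases t) (simp_all add: cop_trajectory_def \<sigma>_def winning_from_def hd_map del: upt_Suc)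
  qed
  then have "winning_strategy G m \<sigma>"
    using \<tau> by (simp add: winning_strategy_def winning_from_def legal_moves_def)
  then show ?thesis
    by (auto simp: cops_win_def)
qed

section \<open>Guards\<close>

text \<open>With cops on \<open>S\<close>, a robber who steps out of \<open>R\<close> is captured on
  their next turn.\<close>

definition guards :: "'a pair_pre_digraph \<Rightarrow> 'a set \<Rightarrow> 'a set \<Rightarrow> bool" where
  "guards G S R \<longleftrightarrow>
     (\<forall>r \<in> R. \<forall>w. (r, w) \<in> parcs G \<longrightarrow> w \<notin> R \<longrightarrow> (\<exists>s \<in> S. (s, w) \<in> (parcs G)\<^sup>=))"

text \<open>Keeping one cop on each vertex of \<open>S\<close> leaves a spare one, who walks to
  \<open>x\<close>. Meanwhile the robber stays in \<open>R\<close> or steps onto or next to a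
  guard.\<close>

lemma robber_lost_send_cop:
  assumes G: "pair_graph G"
    and conn: "\<And>y z. y \<in> pverts G \<Longrightarrow> z \<in> pverts G \<Longrightarrow> (y, z) \<in> (parcs G)\<^sup>*"
    and guards: "guards G S R" and S: "S \<subseteq> c ` {..<m}" "card S < m"
    and c: "c ` {..<m} \<subseteq> pverts G" and r: "r \<in> R" and x: "x \<in> pverts G"
    and arrived: "\<And>c' r'. c' ` {..<m} \<subseteq> pverts G \<Longrightarrow> insert x S \<subseteq> c' ` {..<m} \<Longrightarrow> r' \<in> R \<Longrightarrow>
      robber_lost G m c' r'"
  shows "robber_lost G m c r"
proof -
  interpret pair_graph G by fact
  obtain I where I: "I \<subseteq> {..<m}" "inj_on c I" "S = c ` I"
    using S(1) by (auto simp: subset_image_inj)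
  then have "card I < m"
    using S(2) by (simp add: card_image)
  then obtain j where j: "j < m" "j \<notin> I"
    using I(1) by (metis card_lessThan lessThan_iff less_irrefl subsetI subset_antisym)
  have "robber_lost G m c r"
    if "(y, x) \<in> (parcs G)\<^sup>*" "c j = y" "S = c ` I" "c ` {..<m} \<subseteq> pverts G" "r \<in> R" for y c r
    using that
  proof (induction arbitrary: c r rule: converse_rtrancl_induct)
    case base
    then show ?case
      using arrived[of c r] j I(1) by blast
  next
    case (step y z)
    define c' where "c' = c(j := z)"
    have c': "c' j = z" "S = c' ` I" "c' ` {..<m} \<subseteq> pverts G"
      using step.prems step.hyps(1) j by (auto simp: c'_def dest: in_arcsD2)
    have lost: "robber_lost G m c' r'" if r': "(r, r') \<in> (parcs G)\<^sup>=" for r'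
    proof (cases "r' \<in> R")
      case True
      then show ?thesis
        by (rule step.IH[OF c'])
    next
      case False
      then have "(r, r') \<in> parcs G"
        using r' step.prems(4) by auto
      then obtain i where "i \<in> I" "(c' i, r') \<in> (parcs G)\<^sup>="
        using guards step.prems(4) False unfolding guards_def c'(2) by blast
      then show ?thesis
        using I(1) by (intro robber_lost_capture[of i]) auto
    qed
    have moves: "(c i, c' i) \<in> (parcs G)\<^sup>=" for i
      using step.hyps(1) step.prems(1) by (auto simp: c'_def)
    show ?case
      by (rule pursue[where c' = c', OF moves lost])
  qed
  moreover have "(c j, x) \<in> (parcs G)\<^sup>*"
    using c j x by (intro conn) auto
  ultimately show ?thesis
    using I(3) c r by blast
qed

section \<open>The path argument\<close>

text \<open>An index \<open>i < p\<close> left out is odd with \<open>i + 2 < p\<close>, so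
  \<open>v (i - 1)\<close>, \<open>v (i + 1)\<close> and \<open>v (i + 2)\<close> are among
  \<open>v 0, ..., v (p - 1)\<close>, as needed to build an \<open>E\<close> around
  \<open>v i\<close>.\<close>

definition path_guards :: "(nat \<Rightarrow> 'a) \<Rightarrow> nat \<Rightarrow> 'a set" where
  "path_guards v p = v ` {i. i < p \<and> (even i \<or> p \<le> i + 2)}"

text \<open>The vertex \<open>v p\<close> is the next to be occupied and does not bound
  \<open>R\<close> yet. The reflexive closure in the last clause admits \<open>v p \<in> R\<close>,
  as at the start, where \<open>p = 0\<close> and \<open>R\<close> is the whole vertex set.\<close>

definition territory :: "'a pair_pre_digraph \<Rightarrow> (nat \<Rightarrow> 'a) \<Rightarrow> nat \<Rightarrow> 'a set \<Rightarrow> bool" where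
  "territory G v p R \<longleftrightarrow> R \<subseteq> pverts G \<and>
     (\<forall>x \<in> R. \<forall>y \<in> R. (x, y) \<in> (Restr (parcs G) R)\<^sup>*) \<and>
     (\<forall>i<p. \<forall>x \<in> R. (v i, x) \<notin> (parcs G)\<^sup>=) \<and>
     (\<forall>r \<in> R. \<forall>w. (r, w) \<in> parcs G \<longrightarrow> w \<notin> R \<longrightarrow> (\<exists>i<p. (v i, w) \<in> parcs G)) \<and>
     (\<exists>y \<in> R. (v p, y) \<in> (parcs G)\<^sup>=)"

text \<open>There are \<open>(p + 1) div 2\<close> even indices below \<open>p\<close>, and the last
  two vertices add at most 2.\<close>

lemma card_path_guards: "card (path_guards v p) \<le> (p + 1) div 2 + 2"
proof -
  have "{i. i < p \<and> (even i \<or> p \<le> i + 2)} \<subseteq> (\<lambda>i. 2 * i) ` {..<(p + 1) div 2} \<union> {p - 1, p - 2}"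
    by (auto elim!: evenE)
  moreover have "card ((\<lambda>i. 2 * i) ` {..<(p + 1) div 2} \<union> {p - 1, p - 2}) \<le> (p + 1) div 2 + 2"
    by (rule order.trans[OF card_Un_le add_mono])
      (auto intro: order.trans[OF card_image_le] simp: card_insert_if)
  ultimately have "card {i. i < p \<and> (even i \<or> p \<le> i + 2)} \<le> (p + 1) div 2 + 2"
    by (meson card_mono finite_UnI finite_imageI finite_lessThan finite.emptyI finite.insertI order.trans)
  then show ?thesis
    unfolding path_guards_def by (intro order.trans[OF card_image_le]) auto
qed

text \<open>Old indices can only drop out, since \<open>p + 1 \<le> i + 2\<close> implies
  \<open>p \<le> i + 2\<close>. Hence each prolongation of the path requires just one cop to
  walk.\<close>

lemma path_guards_Suc: "path_guards v (Suc p) \<subseteq> insert (v p) (path_guards v p)"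
  by (auto simp: path_guards_def less_Suc_eq)

lemma path_guards_guard_territory:
  assumes G: "pair_graph G" and E: "induced_free G E_graph"
    and v: "induced_embedding G (path_graph (Suc p)) v" and R: "territory G v p R"
  shows "guards G (path_guards v p) R"
  unfolding guards_def
proof (intro ballI allI impI)
  fix r w
  assume r: "r \<in> R" and rw: "(r, w) \<in> parcs G" and w: "w \<notin> R"
  interpret pair_graph G by fact
  \<comment> \<open>By maximality of \<open>j\<close>, the vertices \<open>v (j + 1)\<close> and
    \<open>v (j + 2)\<close> are not adjacent to \<open>w\<close> if their indices are below
    \<open>p\<close>.\<close>
  define J where "J = {i. i < p \<and> (v i, w) \<in> parcs G}"
  define j where "j = Max J"
  have "finite J" "J \<noteq> {}"
    using R r rw w by (auto simp: J_def territory_def)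
  then have "j \<in> J" and max: "\<And>i. i \<in> J \<Longrightarrow> i \<le> j"
    by (auto simp: j_def)
  then have j: "j < p" "(v j, w) \<in> parcs G"
    by (auto simp: J_def)
  have vE: "(v a, v b) \<in> parcs G \<longleftrightarrow> b = Suc a \<or> a = Suc b"
    and v_inj: "v a = v b \<longleftrightarrow> a = b" if "a \<le> p" "b \<le> p" for a b
    using v that by (auto simp: induced_embedding_def path_graph_def inj_on_def)
  have vV: "v a \<in> pverts G" if "a \<le> p" for a
    using v that by (auto simp: induced_embedding_def path_graph_def)
  have vr: "v i \<noteq> r" "r \<noteq> v i" "(v i, r) \<notin> parcs G" "(r, v i) \<notin> parcs G" if "i < p" for i
    using R r that by (auto simp: territory_def dest: arcs_symmetric)
  \<comment> \<open>\<open>w\<close> is adjacent to \<open>r\<close>, but no \<open>v i\<close> with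
    \<open>i < p\<close> is.\<close>
  have vw: "v i \<noteq> w" "w \<noteq> v i" if "i < p" for i
    using vr[OF that] rw by auto
  show "\<exists>s \<in> path_guards v p. (s, w) \<in> (parcs G)\<^sup>="
  proof (cases "even j \<or> p \<le> j + 2")
    case True
    then show ?thesis
      using j by (auto simp: path_guards_def)
  next
    case False
    then obtain i where i: "j = Suc i"
      by (cases j) auto
    have "(v i, w) \<in> parcs G"
    proof (rule ccontr)
      assume iw: "(v i, w) \<notin> parcs G"
      have far: "(v a, w) \<notin> parcs G" "(w, v a) \<notin> parcs G" if "a = i \<or> j < a" "a < p" for a
        using iw max[of a] that by (auto simp: J_def dest: arcs_symmetric)
      \<comment> \<open>Centre \<open>v j\<close>, pendant vertex \<open>v i\<close>, and the two
        legs \<open>w r\<close> and \<open>v (j + 1) v (j + 2)\<close>, in the order of the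
        constructors.\<close>
      define f where "f = case_E_vertex (v j) (v i) w r (v (Suc j)) (v (Suc (Suc j)))"
      have "induced_embedding G E_graph f"
        unfolding induced_embedding_def
      proof (intro conjI)
        show "inj_on f (pverts E_graph)"
          using False i vr vw rw
          by (auto simp: inj_on_def E_graph_def f_def v_inj dest: no_loops')
        show "f ` pverts E_graph \<subseteq> pverts G"
          using False i vV rw by (auto simp: E_graph_def f_def dest: in_arcsD1 in_arcsD2)
        show "\<forall>x \<in> pverts E_graph. \<forall>y \<in> pverts E_graph. (f x, f y) \<in> parcs G \<longleftrightarrow> (x, y) \<in> parcs E_graph"
          using False i vr far j rw arcs_symmetric[OF rw] arcs_symmetric[OF j(2)] no_loops'[of w w] no_loops'[of r r]
          by (auto simp: E_graph_def f_def vE)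
      qed
      then show False
        using induced_embedding_not_induced_free[OF G pair_graph_E_graph] E by blast
    qed
    moreover have "v i \<in> path_guards v p"
      using False i by (auto simp: path_guards_def)
    ultimately show ?thesis by auto
  qed
qed

lemma territory_Suc:
  assumes G: "pair_graph G"
    and v: "induced_embedding G (path_graph (Suc p)) v" and R: "territory G v p R"
    and r: "r \<in> R" "(v p, r) \<notin> (parcs G)\<^sup>="
  obtains u R' where "induced_embedding G (path_graph (Suc (Suc p))) (v(Suc p := u))"
    "territory G (v(Suc p := u)) (Suc p) R'" "r \<in> R'"
proof -
  interpret pair_graph G by fact
  define D where "D = {x \<in> R. (v p, x) \<notin> (parcs G)\<^sup>=}"
  define R' where "R' = {x. (r, x) \<in> (Restr (parcs G) D)\<^sup>*}"
  have rR': "r \<in> R'"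
    by (simp add: R'_def)
  have R'D: "R' \<subseteq> D"
  proof
    fix x assume "x \<in> R'"
    then have "(r, x) \<in> (Restr (parcs G) D)\<^sup>*"
      by (simp add: R'_def)
    then show "x \<in> D"
      using r by induction (auto simp: D_def)
  qed
  have closed: "y \<in> R'" if "x \<in> R'" "(x, y) \<in> parcs G" "y \<in> D" for x y
    using that R'D unfolding R'_def by (blast intro: rtrancl_into_rtrancl)
  obtain y where y: "y \<in> R" "(v p, y) \<in> (parcs G)\<^sup>="
    using R by (auto simp: territory_def)
  \<comment> \<open>A walk in \<open>R\<close> from \<open>r\<close> to \<open>y\<close> has to
    leave \<open>R'\<close>, since \<open>y\<close> lies in the closed neighbourhood of
    \<open>v p\<close>, which \<open>R'\<close> avoids.\<close>
  have "\<exists>x u. x \<in> R' \<and> u \<in> R - R' \<and> (x, u) \<in> parcs G"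
  proof (rule ccontr)
    assume none: "\<not> ?thesis"
    have "(r, y) \<in> (Restr (parcs G) R)\<^sup>*"
      using R r y by (auto simp: territory_def)
    then have "y \<in> R'"
      using none by induction (use rR' in auto)
    then show False
      using R'D y by (auto simp: D_def)
  qed
  then obtain x u where xu: "x \<in> R'" "u \<in> R" "u \<notin> R'" "(x, u) \<in> parcs G"
    by auto
  \<comment> \<open>Otherwise \<open>u\<close> would lie in \<open>D\<close> and hence in
    \<open>R'\<close>. Nor is \<open>u\<close> equal to \<open>v p\<close>, which has no neighbour
    in \<open>R'\<close>.\<close>
  have "(v p, u) \<in> (parcs G)\<^sup>="
    using closed[OF xu(1,4)] xu by (auto simp: D_def)
  moreover have "v p \<noteq> u"
    using xu R'D by (auto simp: D_def dest: arcs_symmetric)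
  ultimately have pu: "(v p, u) \<in> parcs G"
    by auto
  define v' where "v' = v(Suc p := u)"
  have v': "v' i = v i" if "i \<le> p" for i
    using that by (simp add: v'_def)
  \<comment> \<open>As a vertex of \<open>R\<close>, \<open>u\<close> avoids the closed
    neighbourhoods of these \<open>v i\<close>; this keeps the prolonged path induced.\<close>
  have vu: "v i \<noteq> u" "(v i, u) \<notin> parcs G" "(u, v i) \<notin> parcs G" if "i < p" for i
    using R xu that by (auto simp: territory_def dest: arcs_symmetric)
  have "induced_embedding G (path_graph (Suc (Suc p))) v'"
    unfolding induced_embedding_def
  proof (intro conjI)
    have new: "v' (Suc p) = u"
      by (simp add: v'_def)
    have u: "v i \<noteq> u" "(v i, u) \<in> parcs G \<longleftrightarrow> i = p" "(u, v i) \<in> parcs G \<longleftrightarrow> i = p" if "i \<le> p" for i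
      using that vu[of i] pu arcs_symmetric[OF pu] \<open>v p \<noteq> u\<close> by (cases "i = p"; simp)+
    have inj: "inj_on v {..p}" and sub: "v ` {..p} \<subseteq> pverts G"
      and vE: "\<And>i j. i \<le> p \<Longrightarrow> j \<le> p \<Longrightarrow> (v i, v j) \<in> parcs G \<longleftrightarrow> j = Suc i \<or> i = Suc j"
      using v by (auto simp: induced_embedding_def path_graph_def lessThan_Suc_atMost)
    have verts: "pverts (path_graph (Suc (Suc p))) = insert (Suc p) {..p}"
      by (auto simp: path_graph_def)
    show "inj_on v' (pverts (path_graph (Suc (Suc p))))"
      unfolding verts inj_on_insert using inj u by (auto simp: inj_on_def v' new)
    show "v' ` pverts (path_graph (Suc (Suc p))) \<subseteq> pverts G"
      unfolding verts using sub in_arcsD2[OF pu] by (auto simp: v' new)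
    have "(v' i, v' j) \<in> parcs G \<longleftrightarrow> j = Suc i \<or> i = Suc j" if "i \<le> Suc p" "j \<le> Suc p" for i j
      using that u vE no_loops'[of u u] by (cases "i = Suc p"; cases "j = Suc p") (auto simp: v' new)
    then show "\<forall>i \<in> pverts (path_graph (Suc (Suc p))). \<forall>j \<in> pverts (path_graph (Suc (Suc p))).
        (v' i, v' j) \<in> parcs G \<longleftrightarrow> (i, j) \<in> parcs (path_graph (Suc (Suc p)))"
      by (auto simp: path_graph_def)
  qed
  moreover have "territory G v' (Suc p) R'"
    unfolding territory_def
  proof (intro conjI)
    show "R' \<subseteq> pverts G"
      using R'D R by (auto simp: D_def territory_def)
    \<comment> \<open>\<open>R'\<close> is defined by walks in \<open>D\<close>, but every vertex on
      such a walk from \<open>r\<close> is itself in \<open>R'\<close>.\<close>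
    have reach: "(r, z) \<in> (Restr (parcs G) R')\<^sup>*" if "z \<in> R'" for z
    proof -
      have "(r, z) \<in> (Restr (parcs G) D)\<^sup>*"
        using that by (simp add: R'_def)
      then show ?thesis
      proof induction
        case (step a b)
        then have "a \<in> R'" "b \<in> R'"
          by (auto simp: R'_def intro: rtrancl_into_rtrancl)
        with step show ?case
          by (auto intro: rtrancl_into_rtrancl)
      qed simp
    qed
    have "sym (Restr (parcs G) R')"
      by (auto simp: sym_def dest: arcs_symmetric)
    then show "\<forall>a \<in> R'. \<forall>b \<in> R'. (a, b) \<in> (Restr (parcs G) R')\<^sup>*"
      using reach by (meson rtrancl_trans sym_rtrancl symD)
    show "\<forall>i<Suc p. \<forall>z \<in> R'. (v' i, z) \<notin> (parcs G)\<^sup>="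
    proof (intro allI impI ballI)
      fix i z assume "i < Suc p" "z \<in> R'"
      moreover from this have "z \<in> R" "(v p, z) \<notin> (parcs G)\<^sup>="
        using R'D by (auto simp: D_def)
      ultimately show "(v' i, z) \<notin> (parcs G)\<^sup>="
        using R v'[of i] by (cases "i = p") (auto simp: territory_def)
    qed
    show "\<forall>z \<in> R'. \<forall>w. (z, w) \<in> parcs G \<longrightarrow> w \<notin> R' \<longrightarrow> (\<exists>i<Suc p. (v' i, w) \<in> parcs G)"
    proof (intro ballI allI impI)
      fix z w assume z: "z \<in> R'" "(z, w) \<in> parcs G" "w \<notin> R'"
      then have "w \<notin> D" and zD: "z \<in> D"
        using closed R'D by auto
      show "\<exists>i<Suc p. (v' i, w) \<in> parcs G"
      \<comment> \<open>An exit inside \<open>R\<close> is outside \<open>D\<close> and so adjacent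
        to \<open>v p\<close>; an exit outside \<open>R\<close> is already an exit of the old
        territory.\<close>
      proof (cases "w \<in> R")
        case True
        moreover have "w \<noteq> v p"
          using zD z(2) by (auto simp: D_def dest: arcs_symmetric)
        ultimately have "(v p, w) \<in> parcs G"
          using \<open>w \<notin> D\<close> by (auto simp: D_def)
        then show ?thesis
          using v' by auto
      next
        case False
        moreover have "z \<in> R"
          using zD by (simp add: D_def)
        ultimately obtain i where "i < p" "(v i, w) \<in> parcs G"
          using R z(2) unfolding territory_def by blast
        then show ?thesis
          using v'[of i] by (auto intro!: exI[of _ i])
      qed
    qed
    show "\<exists>y \<in> R'. (v' (Suc p), y) \<in> (parcs G)\<^sup>="
      using xu arcs_symmetric[OF xu(4)] by (auto simp: v'_def)
  qed
  ultimately show ?thesis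
    using that rR' by (simp add: v'_def)
qed

text \<open>Each round of the induction sends a cop to \<open>v p\<close>; the robber is then
  captured or the path gains a vertex. This ends because \<open>p + 1 = k\<close> would give an
  induced path on \<open>k\<close> vertices.\<close>

lemma robber_lost_in_territory:
  assumes G: "pair_graph G"
    and conn: "\<And>y z. y \<in> pverts G \<Longrightarrow> z \<in> pverts G \<Longrightarrow> (y, z) \<in> (parcs G)\<^sup>*"
    and P: "induced_free G (path_graph k)" and E: "induced_free G E_graph"
    and "induced_embedding G (path_graph (Suc p)) v" and "territory G v p R"
    and "c ` {..<m} \<subseteq> pverts G" and "path_guards v p \<subseteq> c ` {..<m}" and "r \<in> R"
    and m: "k div 2 + 3 \<le> m" and "p < k"
  shows "robber_lost G m c r"
  using assms(5-9,11)
proof (induction "k - p" arbitrary: p v R c r rule: less_induct)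
  case less
  have "Suc p \<noteq> k"
    using less.prems(1) P induced_embedding_not_induced_free[OF G pair_graph_path_graph] by blast
  then have p: "Suc p < k"
    using less.prems(6) by simp
  \<comment> \<open>The bound \<open>(p + 1) div 2 + 2 \<le> k div 2 + 2\<close> leaves a spare
    cop.\<close>
  then have card: "card (path_guards v p) < m"
    using card_path_guards[of v p] m by linarith
  have vp: "v p \<in> pverts G"
    using less.prems(1) by (auto simp: induced_embedding_def path_graph_def)
  show ?case
  proof (rule robber_lost_send_cop[OF G conn path_guards_guard_territory[OF G E less.prems(1,2)]
        less.prems(4) card less.prems(3,5) vp])
    fix c' r'
    assume c': "c' ` {..<m} \<subseteq> pverts G" "insert (v p) (path_guards v p) \<subseteq> c' ` {..<m}" and r': "r' \<in> R"
    show "robber_lost G m c' r'"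
    proof (cases "(v p, r') \<in> (parcs G)\<^sup>=")
      case True
      moreover obtain i where "i < m" "c' i = v p"
        using c'(2) by auto
      ultimately show ?thesis
        by (intro robber_lost_capture[of i]) auto
    next
      case False
      then obtain u R' where *: "induced_embedding G (path_graph (Suc (Suc p))) (v(Suc p := u))"
          "territory G (v(Suc p := u)) (Suc p) R'" "r' \<in> R'"
        using territory_Suc[OF G less.prems(1,2) r'] by blast
      \<comment> \<open>Guards have index at most \<open>p\<close>, where the path is
        unchanged.\<close>
      have "path_guards (v(Suc p := u)) (Suc p) = path_guards v (Suc p)"
        by (auto simp: path_guards_def)
      then have guards: "path_guards (v(Suc p := u)) (Suc p) \<subseteq> c' ` {..<m}"
        using order.trans[OF path_guards_Suc c'(2)] by simp
      have "k - Suc p < k - p"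
        using p by simp
      then show ?thesis
        by (rule less.hyps[OF _ *(1,2) c'(1) guards *(3) p])
    qed
  qed
qed

theorem theorem1p5:
  fixes G :: "'a pair_pre_digraph" and k :: nat
  assumes "k > 0"
    and "pair_graph G"
    and "Digraph_Component.connected (with_proj G)"
    and "induced_free G (path_graph k)"
    and "induced_free G E_graph"
  shows "int (cop_number G) \<le> \<lceil>(real k - 1) / 2\<rceil> + 3"
proof -
  interpret pair_graph G by fact
  \<comment> \<open>\<open>k div 2\<close> is the ceiling of \<open>(k - 1) / 2\<close>.\<close>
  define m where "m = k div 2 + 3"
  have conn: "(y, z) \<in> (parcs G)\<^sup>*" if "y \<in> pverts G" "z \<in> pverts G" for y z
  proof -
    have "y \<rightarrow>\<^sup>*\<^bsub>with_proj G\<^esub> z"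
      using assms(3) that reachable_mk_symmetric_eq[OF pair_sym_arcs]
      by (auto simp: connected_def strongly_connected_def)
    then show ?thesis
      by (auto simp: reachable_def dest: rtrancl_on_rtranclI)
  qed
  obtain x where x: "x \<in> pverts G"
    using assms(3) by (auto simp: connected_def strongly_connected_def)
  have "Restr (parcs G) (pverts G) = parcs G"
    by (auto dest: in_arcsD1 in_arcsD2)
  \<comment> \<open>All cops start at \<open>x\<close>, which alone forms the first path; no guards
    are needed yet.\<close>
  then have "territory G (\<lambda>_. x) 0 (pverts G)"
    using x conn by (auto simp: territory_def dest: in_arcsD2)
  moreover have "induced_embedding G (path_graph (Suc 0)) (\<lambda>_. x)"
    using x by (auto simp: induced_embedding_def path_graph_def lessThan_Suc dest: no_loops')
  ultimately have "robber_lost G m (\<lambda>_. x) r" if "r \<in> pverts G" for r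
    using x that assms(1)
    by (intro robber_lost_in_territory[OF assms(2) conn assms(4,5), where p = 0])
      (auto simp: m_def path_guards_def)
  then have "cops_win G m"
    using x by (intro robber_lost_cops_win[OF assms(2)]) auto
  then have "cop_number G \<le> m"
    unfolding cop_number_def by (rule Least_le)
  moreover have "int (k div 2) \<le> \<lceil>(real k - 1) / 2\<rceil>"
    by (simp add: le_ceiling_iff)
  ultimately show ?thesis
    by (simp add: m_def)
qed

end
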